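(* Let $(X,\sigma)$ be an OTW-subshift over a countable alphabet $A$ such that $(X,\sigma)$, with $\operatorname{Dom}(\sigma)$ the set of elements of $X$ of length greater than zero, is a DR system. Let $\Omega$ and $\mathfrak{W}$ be its sets of nonwandering and wandering points. Then the following hold: 1. Every rational element of $X$ belongs to $\Omega$. 2. If $z\in X$ is such that every open neighborhood of $z$ contains a rational element, then $z\in\Omega$. 3. Every irrational infinite sequence in $X$ that is an isolated point of $X$ belongs to $\mathfrak{W}$. 4. Either all elements of $X$ of finite length belong to $\Omega$, or all elements of $X$ of finite length belong to $\mathfrak{W}$. Moreover, the classification of the empty word determines that of all finite-length elements: if the empty word is in $\Omega$ then all finite-length elements are in $\Omega$, and if the empty word is in $\mathfrak{W}$ then all finite-length elements are in $\mathfrak{W}$.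
   Context: A DR (Deaconu-Renault) system $(X,\sigma)$ consists of a locally compact Hausdorff space $X$ and a local homeomorphism $\sigma:\operatorname{Dom}(\sigma)\to\operatorname{Im}(\sigma)$ from an open set $\operatorname{Dom}(\sigma)\subseteq X$ onto an open set $\operatorname{Im}(\sigma)\subseteq X$. Iterates $\sigma^n$ are compositions of the partially defined map $\sigma$ on their natural domains $\operatorname{Dom}(\sigma^n)$, with $\sigma^0=\mathrm{id}$ and $\operatorname{Dom}(\sigma^0)=X$. For any $Y\subseteq X$ and $n\ge 0$, $\sigma^n(Y)$ means $\sigma^n(Y\cap\operatorname{Dom}(\sigma^n))$; for $k<0$, $\sigma^k(Y)=\{x\in\operatorname{Dom}(\sigma^{-k}):\sigma^{-k}(x)\in Y\}$. A point $x\in X$ is wandering if there is an open neighborhood $U$ of $x$ with $\sigma^n(U)\cap\sigma^{-k}(\sigma^k(U))=\emptyset$ for all $n\ge1$ and all $k\in\mathbb{Z}$; otherwise it is nonwandering. OTW (Ott-Tomforde-Willis) subshifts. Let $A$ be a countable alphabet; let $\tilde A=A$ if $A$ is finite and $\tilde A=A\cup\{\infty\}$, with $\infty\notin A$ a new symbol, if $A$ is infinite. Let $\Sigma_A$ be the set of sequences $x=(x_i)_{i\ge0}$ in $\tilde A$ such that $x_i=\infty$ implies $x_{i+1}=\infty$; let $\Sigma_A^{\mathrm{inf}}$ be the set of sequences with all entries in $A$, and $\Sigma_A^{\mathrm{fin}}=\Sigma_A\setminus\Sigma_A^{\mathrm{inf}}$. If $A$ is infinite, an element $(x_0,\dots,x_k,\infty,\infty,\dots)$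 is identified with the finite word $x_0\cdots x_k$ over $A$ (of length $k+1$), and $w=(\infty,\infty,\dots)$ with the empty word (of length $0$); elements of $\Sigma_A^{\mathrm{inf}}$ have infinite length. A block of an infinite sequence $x$ is a finite string of consecutive entries $x_k\cdots x_j$. Given a set $F$ of finite words over $A$, let $\mathsf{X}_F^{\mathrm{inf}}$ be the set of $x\in\Sigma_A^{\mathrm{inf}}$ no block of which is in $F$, and let $\mathsf{X}_F^{\mathrm{fin}}$ be the set of $x\in\Sigma_A^{\mathrm{fin}}$ for which there are infinitely many $a\in A$ such that some $y\in\Sigma_A^{\mathrm{inf}}$ satisfies $xay\in\mathsf{X}_F^{\mathrm{inf}}$. The OTW-subshift associated with $F$ is $X=\mathsf{X}_F^{\mathrm{inf}}\cup\mathsf{X}_F^{\mathrm{fin}}$. As a partially defined map, the shift $\sigma$ has $\operatorname{Dom}(\sigma)=X\setminus\{w\}$ (elements of length greater than zero) and deletes the first letter: $\sigma(x_0x_1x_2\cdots)=x_1x_2\cdots$ for infinite sequences, $\sigma(x_0\cdots x_{n-1})=x_1\cdots x_{n-1}$ for words of length $n\ge2$, and $\sigma(x_0)=w$ for words of length $1$. The topology of $X$ has as a basis the generalized cylinder sets $\mathcal{Z}(\alpha,G)$, where $\alpha$ is a finite (possibly empty) word over $A$ and $G\subseteq A$ is finite: $\mathcal{Z}(\alpha,G)$ is the set of $y\in X$ whose first $|\alpha|$ entries form $\alpha$ and whose next entry does not belong to $G$. An infinite sequence $x\in X$ is rational (eventually periodic) if $x=\alpha\beta^\infty$ for finite words $\alpha,\beta$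 with $|\alpha|\ge0$, $|\beta|\ge1$; an infinite sequence that is not rational is irrational. *)

theory Defs
  imports "HOL-Analysis.Analysis" "HOL-Library.Omega_Words_Fun"
begin

section \<open>Deaconu-Renault systems\<close>

text \<open>
  A partially defined map is a total function \<open>f\<close> together with its domain \<open>D\<close>; the values of
  \<open>f\<close> outside \<open>D\<close> are irrelevant. The space \<open>X\<close> is the topspace of \<open>T\<close>.
\<close>

locale DR_system =
  fixes T :: "'x topology" and D :: "'x set" and f :: "'x \<Rightarrow> 'x"
  assumes locally_compact: "locally_compact_space T"
    and Hausdorff: "Hausdorff_space T"
    and open_Dom: "openin T D"
    and open_Im: "openin T (f ` D)"
    and local_homeo:
      "\<And>x. x \<in> D \<Longrightarrow> \<exists>U. openin T U \<and> x \<in> U \<and> U \<subseteq> D \<and> openin T (f ` U) \<and>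
         homeomorphic_map (subtopology T U) (subtopology T (f ` U)) f"

text \<open>\<open>Dom (\<sigma>\<^sup>n)\<close>; on this set \<open>\<sigma>\<^sup>n\<close> is \<open>f ^^ n\<close>.\<close>

primrec dom_pow :: "'x topology \<Rightarrow> 'x set \<Rightarrow> ('x \<Rightarrow> 'x) \<Rightarrow> nat \<Rightarrow> 'x set" where
  "dom_pow T D f 0 = topspace T"
| "dom_pow T D f (Suc n) = {x \<in> D. f x \<in> dom_pow T D f n}"

text \<open>\<open>\<sigma>\<^sup>k(Y)\<close> for \<open>k\<close> in \<open>\<int>\<close>: a forward image for \<open>k \<ge> 0\<close>, a preimage for \<open>k < 0\<close>.\<close>

definition pow_image ::
  "'x topology \<Rightarrow> 'x set \<Rightarrow> ('x \<Rightarrow> 'x) \<Rightarrow> int \<Rightarrow> 'x set \<Rightarrow> 'x set" where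
  "pow_image T D f k Y =
     (if k \<ge> 0 then (f ^^ nat k) ` (Y \<inter> dom_pow T D f (nat k))
      else {x \<in> dom_pow T D f (nat (- k)). (f ^^ nat (- k)) x \<in> Y})"

definition wandering_points :: "'x topology \<Rightarrow> 'x set \<Rightarrow> ('x \<Rightarrow> 'x) \<Rightarrow> 'x set" where
  "wandering_points T D f =
     {x \<in> topspace T. \<exists>U. openin T U \<and> x \<in> U \<and>
        (\<forall>n\<ge>1. \<forall>k. pow_image T D f n U \<inter> pow_image T D f (- k) (pow_image T D f k U) = {})}"

definition nonwandering_points :: "'x topology \<Rightarrow> 'x set \<Rightarrow> ('x \<Rightarrow> 'x) \<Rightarrow> 'x set" where
  "nonwandering_points T D f = topspace T - wandering_points T D f"


section \<open>Ott-Tomforde-Willis subshifts\<close>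

text \<open>
  The symbol \<open>\<infinity>\<close> is encoded as \<^const>\<open>None\<close> and a letter \<open>a\<close> as \<open>Some a\<close>.
\<close>

definition ext_alphabet :: "'a set \<Rightarrow> 'a option set" where
  "ext_alphabet A = (if finite A then Some ` A else insert None (Some ` A))"

definition full_seqs :: "'a set \<Rightarrow> 'a option word set" where
  "full_seqs A = {x. range x \<subseteq> ext_alphabet A \<and> (\<forall>i. x i = None \<longrightarrow> x (Suc i) = None)}"

definition full_inf :: "'a set \<Rightarrow> 'a option word set" where
  "full_inf A = {x \<in> full_seqs A. range x \<subseteq> Some ` A}"

definition full_fin :: "'a set \<Rightarrow> 'a option word set" where
  "full_fin A = full_seqs A - full_inf A"

definition empty_word :: "'a option word" where
  "empty_word = (\<lambda>_. None)"

text \<open>The finite word \<open>\<alpha>\<close> viewed as the sequence \<open>\<alpha>\<infinity>\<infinity>\<dots>\<close>.\<close>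

definition fin_word :: "'a list \<Rightarrow> 'a option word" where
  "fin_word \<alpha> = map Some \<alpha> \<frown> empty_word"

text \<open>Blocks are nonempty, so whether \<open>F\<close> contains the empty word does not matter.\<close>

definition otw_inf :: "'a set \<Rightarrow> 'a list set \<Rightarrow> 'a option word set" where
  "otw_inf A F =
     {x \<in> full_inf A. \<forall>k j. k \<le> j \<longrightarrow> subsequence x k (Suc j) \<notin> map Some ` F}"

definition otw_fin :: "'a set \<Rightarrow> 'a list set \<Rightarrow> 'a option word set" where
  "otw_fin A F =
     {x \<in> full_fin A. \<exists>\<alpha>. x = fin_word \<alpha> \<and>
        infinite {a \<in> A. \<exists>y \<in> full_inf A. map Some (\<alpha> @ [a]) \<frown> y \<in> otw_inf A F}}"

definition otw_subshift :: "'a set \<Rightarrow> 'a list set \<Rightarrow> 'a option word set" where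
  "otw_subshift A F = otw_inf A F \<union> otw_fin A F"

definition cylinder :: "'a set \<Rightarrow> 'a list set \<Rightarrow> 'a list \<Rightarrow> 'a set \<Rightarrow> 'a option word set" where
  "cylinder A F \<alpha> G =
     {y \<in> otw_subshift A F. prefix (length \<alpha>) y = map Some \<alpha> \<and> y (length \<alpha>) \<notin> Some ` G}"

definition is_cylinder :: "'a set \<Rightarrow> 'a list set \<Rightarrow> 'a option word set \<Rightarrow> bool" where
  "is_cylinder A F V \<longleftrightarrow> (\<exists>\<alpha> \<in> lists A. \<exists>G. G \<subseteq> A \<and> finite G \<and> V = cylinder A F \<alpha> G)"

definition otw_topology :: "'a set \<Rightarrow> 'a list set \<Rightarrow> 'a option word topology" where
  "otw_topology A F = topology (arbitrary union_of is_cylinder A F)"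

definition otw_dom :: "'a set \<Rightarrow> 'a list set \<Rightarrow> 'a option word set" where
  "otw_dom A F = otw_subshift A F - {empty_word}"

definition shift :: "'a option word \<Rightarrow> 'a option word" where
  "shift x = suffix 1 x"

abbreviation otw_nonwandering :: "'a set \<Rightarrow> 'a list set \<Rightarrow> 'a option word set" where
  "otw_nonwandering A F \<equiv> nonwandering_points (otw_topology A F) (otw_dom A F) shift"

abbreviation otw_wandering :: "'a set \<Rightarrow> 'a list set \<Rightarrow> 'a option word set" where
  "otw_wandering A F \<equiv> wandering_points (otw_topology A F) (otw_dom A F) shift"

definition rational :: "'a set \<Rightarrow> 'a option word \<Rightarrow> bool" where
  "rational A x \<longleftrightarrow>
     (\<exists>\<alpha> \<in> lists A. \<exists>\<beta> \<in> lists A. \<beta> \<noteq> [] \<and> x = map Some \<alpha> \<frown> (map Some \<beta>)\<^sup>\<omega>)"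


subsection \<open>The cylinder sets form a basis of a topology on the subshift\<close>

lemma cylinder_Int:
  assumes x: "x \<in> cylinder A F \<alpha> G" "x \<in> cylinder A F \<beta> H" and le: "length \<alpha> \<le> length \<beta>"
    and "is_cylinder A F (cylinder A F \<alpha> G)" "is_cylinder A F (cylinder A F \<beta> H)"
    and GH: "\<beta> \<in> lists A" "G \<subseteq> A" "finite G" "H \<subseteq> A" "finite H"
  shows "\<exists>V. is_cylinder A F V \<and> x \<in> V \<and> V \<subseteq> cylinder A F \<alpha> G \<inter> cylinder A F \<beta> H"
proof -
  have nth: "y \<in> cylinder A F \<gamma> K \<longleftrightarrow> y \<in> otw_subshift A F \<and>
      (\<forall>i<length \<gamma>. y i = Some (\<gamma> ! i)) \<and> y (length \<gamma>) \<notin> Some ` K" for y \<gamma> K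
  proof -
    have "prefix (length \<gamma>) y = map Some \<gamma> \<longleftrightarrow> (\<forall>i<length \<gamma>. y i = Some (\<gamma> ! i))"
      by (subst list_eq_iff_nth_eq) simp
    then show ?thesis unfolding cylinder_def by blast
  qed
  show ?thesis
  proof (cases "length \<alpha> = length \<beta>")
    case True
    have "\<alpha> = \<beta>"
    proof (rule nth_equalityI)
      show "\<alpha> ! i = \<beta> ! i" if "i < length \<alpha>" for i
        using x that True unfolding nth by (metis option.inject)
    qed (fact True)
    have "cylinder A F \<beta> (G \<union> H) = cylinder A F \<alpha> G \<inter> cylinder A F \<beta> H"
      unfolding \<open>\<alpha> = \<beta>\<close> cylinder_def by blast
    moreover have "is_cylinder A F (cylinder A F \<beta> (G \<union> H))"
      unfolding is_cylinder_def
      by (rule bexI[of _ \<beta>], rule exI[of _ "G \<union> H"]) (use GH in simp_all)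
    ultimately show ?thesis using x by auto
  next
    case False
    with le have lt: "length \<alpha> < length \<beta>" by simp
    have "y \<in> cylinder A F \<alpha> G" if y: "y \<in> cylinder A F \<beta> H" for y
    proof -
      have "y i = x i" if "i < length \<beta>" for i
        using x(2) y that unfolding nth by simp
      moreover have "y \<in> otw_subshift A F"
        using y unfolding nth by blast
      ultimately show ?thesis using x(1) lt unfolding nth by simp
    qed
    then show ?thesis using x assms(5) by blast
  qed
qed

lemma openin_otw_topology:
  "openin (otw_topology A F) = arbitrary union_of is_cylinder A F"
proof -
  have "(arbitrary union_of is_cylinder A F) (S \<inter> T)"
    if S: "is_cylinder A F S" and T: "is_cylinder A F T" for S T
  proof -
    obtain \<alpha> G where 1: "S = cylinder A F \<alpha> G" "\<alpha> \<in> lists A" "G \<subseteq> A" "finite G"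
      using S by (auto simp: is_cylinder_def)
    obtain \<beta> H where 2: "T = cylinder A F \<beta> H" "\<beta> \<in> lists A" "H \<subseteq> A" "finite H"
      using T by (auto simp: is_cylinder_def)
    have "\<exists>V. is_cylinder A F V \<and> x \<in> V \<and> V \<subseteq> S \<inter> T" if x: "x \<in> S \<inter> T" for x
    proof (cases "length \<alpha> \<le> length \<beta>")
      case True
      show ?thesis unfolding 1(1) 2(1)
        by (rule cylinder_Int) (use True S T x 1 2 in blast)+
    next
      case False
      then have le: "length \<beta> \<le> length \<alpha>" by simp
      show ?thesis unfolding 1(1) 2(1) Int_commute[of "cylinder A F \<alpha> G"]
        by (rule cylinder_Int) (use le S T x 1 2 in blast)+
    qed
    then show ?thesis
      unfolding arbitrary_union_of_alt by blast
  qed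
  then show ?thesis
    unfolding otw_topology_def by (intro topology_inverse') (simp only: istopology_base_eq, blast)
qed

lemma topspace_otw_topology: "topspace (otw_topology A F) = otw_subshift A F"
proof -
  have "is_cylinder A F (otw_subshift A F)"
    unfolding is_cylinder_def cylinder_def
    by (rule bexI[of _ "[]"], rule exI[of _ "{}"]) (simp_all)
  then have "openin (otw_topology A F) (otw_subshift A F)"
    unfolding openin_otw_topology by (rule arbitrary_union_of_inc)
  moreover have "S \<subseteq> otw_subshift A F" if "openin (otw_topology A F) S" for S
    using that unfolding openin_otw_topology arbitrary_union_of_alt is_cylinder_def cylinder_def
    by blast
  ultimately show ?thesis
    by (intro subset_antisym openin_subset) auto
qed

end

theory Submission
  imports Defs
begin

text \<open>
  A point is nonwandering iff each of its open neighbourhoods \<open>U\<close> contains \<open>u\<close> and \<open>v\<close> whose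
  orbits merge with a positive lag: \<open>\<sigma>\<^sup>n\<^sup>+\<^sup>k(u) = \<sigma>\<^sup>k(v)\<close> for some \<open>n \<ge> 1\<close> and \<open>k \<ge> 0\<close>
  (\<open>DR_system.nonwandering_iff\<close>; negative exponents give nothing new). For an infinite sequence
  \<open>x\<close>, the equation with \<open>u = v = x\<close> says exactly that \<open>x\<close> is eventually periodic. Hence rational
  elements are nonwandering, and so is every point all of whose neighbourhoods contain one. An
  isolated irrational point is wandering, because its neighbourhood \<open>{x}\<close> leaves no other choice
  of \<open>u\<close> and \<open>v\<close>.

  For finite words the key fact holds in every DR system: a point \<open>x\<close> of the domain is nonwandering
  iff \<open>\<sigma>(x)\<close> is (\<open>DR_system.nonwandering_image_iff\<close>). In one direction a pair \<open>u\<close>, \<open>v\<close> near \<open>x\<close>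
  is pushed forward by the continuous map \<open>\<sigma>\<close>; in the other, a pair near \<open>\<sigma>(x)\<close> is lifted,
  which is possible because \<open>\<sigma>\<close> is open. Wandering is therefore constant along orbits, and the
  orbit of every finite word ends in the empty word.
\<close>

section \<open>Nonwandering points of Deaconu-Renault systems\<close>

context DR_system
begin

lemma Dom_subset: "D \<subseteq> topspace T"
  using open_Dom by (rule openin_subset)

lemma map_in_topspace: "x \<in> D \<Longrightarrow> f x \<in> topspace T"
  using openin_subset[OF open_Im] by blast

lemma dom_pow_subset: "dom_pow T D f n \<subseteq> topspace T"
  using Dom_subset by (cases n) auto

lemma dom_pow_add:
  "x \<in> dom_pow T D f (n + k) \<longleftrightarrow> x \<in> dom_pow T D f n \<and> (f ^^ n) x \<in> dom_pow T D f k"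
proof (induction n arbitrary: x)
  case 0
  then show ?case using dom_pow_subset by auto
next
  case (Suc n)
  then show ?case by (auto simp: funpow_swap1)
qed

lemma funpow_add_apply: "(f ^^ (n + k)) x = (f ^^ k) ((f ^^ n) x)"
  by (simp add: funpow_add add.commute[of n k])

lemma openin_image:
  assumes "openin T U"
  shows "openin T (f ` (U \<inter> D))"
proof (subst openin_subopen, intro ballI)
  fix y assume "y \<in> f ` (U \<inter> D)"
  then obtain x where x: "x \<in> U" "x \<in> D" "y = f x" by blast
  obtain W where W: "openin T W" "x \<in> W" "W \<subseteq> D" "openin T (f ` W)"
    and hom: "homeomorphic_map (subtopology T W) (subtopology T (f ` W)) f"
    using local_homeo[OF x(2)] by blast
  have "openin (subtopology T (f ` W)) (f ` (U \<inter> W))"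
    using homeomorphic_imp_open_map[OF hom] assms
    by (auto simp: open_map_def openin_subtopology_Int)
  then have "openin T (f ` (U \<inter> W))"
    using W(4) by (rule openin_trans_full)
  then show "\<exists>S. openin T S \<and> y \<in> S \<and> S \<subseteq> f ` (U \<inter> D)"
    using x W by blast
qed

lemma openin_preimage:
  assumes "openin T V"
  shows "openin T {x \<in> D. f x \<in> V}"
proof (subst openin_subopen, intro ballI)
  fix x assume x: "x \<in> {x \<in> D. f x \<in> V}"
  then obtain W where W: "openin T W" "x \<in> W" "W \<subseteq> D"
    and hom: "homeomorphic_map (subtopology T W) (subtopology T (f ` W)) f"
    using local_homeo[of x] by blast
  have W_top: "W \<subseteq> topspace T" using W(1) by (rule openin_subset)
  have "continuous_map (subtopology T W) T f"
    using homeomorphic_imp_continuous_map[OF hom]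
    by (simp add: continuous_map_in_subtopology)
  from openin_continuous_map_preimage[OF this assms]
  have "openin (subtopology T W) {y \<in> W. f y \<in> V}"
    using W_top by (simp add: Int_absorb1)
  then have "openin T {y \<in> W. f y \<in> V}"
    using W(1) by (rule openin_trans_full)
  then show "\<exists>S. openin T S \<and> x \<in> S \<and> S \<subseteq> {x \<in> D. f x \<in> V}"
    using x W by blast
qed

text \<open>
  For negative \<open>k\<close> the set \<open>\<sigma>\<^sup>-\<^sup>k(\<sigma>\<^sup>k(U))\<close> is contained in \<open>U\<close>, which is the set for \<open>k = 0\<close>;
  so only the natural numbers \<open>k\<close> matter.
\<close>

lemma pow_image_disjoint_iff:
  assumes U: "U \<subseteq> topspace T"
  shows "(\<forall>k::int. pow_image T D f (int n) U \<inter>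
            pow_image T D f (- k) (pow_image T D f k U) = {}) \<longleftrightarrow>
         \<not> (\<exists>k. \<exists>u\<in>U. \<exists>v\<in>U. u \<in> dom_pow T D f (n + k) \<and> v \<in> dom_pow T D f k \<and>
              (f ^^ (n + k)) u = (f ^^ k) v)"
    (is "(\<forall>k. ?L k = {}) \<longleftrightarrow> \<not> (\<exists>k. ?R k)")
proof -
  have nonneg: "?L (int k) \<noteq> {} \<longleftrightarrow> ?R k" for k
  proof -
    have saturation: "pow_image T D f (- int k) (pow_image T D f (int k) U) =
        {y \<in> dom_pow T D f k. \<exists>v\<in>U. v \<in> dom_pow T D f k \<and> (f ^^ k) y = (f ^^ k) v}"
      using U by (cases "k = 0") (auto simp: pow_image_def)
    have "?L (int k) \<noteq> {} \<longleftrightarrow> (\<exists>u\<in>U. \<exists>v\<in>U. u \<in> dom_pow T D f n \<and>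
        (f ^^ n) u \<in> dom_pow T D f k \<and> v \<in> dom_pow T D f k \<and> (f ^^ k) ((f ^^ n) u) = (f ^^ k) v)"
      unfolding saturation by (auto simp: pow_image_def)
    also have "\<dots> \<longleftrightarrow> ?R k"
      unfolding dom_pow_add funpow_add_apply by blast
    finally show ?thesis .
  qed
  have neg: "?L k \<subseteq> ?L (int 0)" if "k < 0" for k
    using that U by (auto simp: pow_image_def)
  show ?thesis
  proof
    assume "\<forall>k. ?L k = {}"
    then show "\<not> (\<exists>k. ?R k)" using nonneg by blast
  next
    assume R: "\<not> (\<exists>k. ?R k)"
    then have nat: "?L (int k) = {}" for k using nonneg by blast
    show "\<forall>k. ?L k = {}"
    proof
      fix k :: int
      show "?L k = {}"
      proof (cases "k < 0")
        case True
        then show ?thesis using neg[of k] nat[of 0] by blast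
      next
        case False
        then show ?thesis using nat[of "nat k"] by simp
      qed
    qed
  qed
qed

lemma nonwandering_iff:
  "x \<in> nonwandering_points T D f \<longleftrightarrow> x \<in> topspace T \<and>
     (\<forall>U. openin T U \<and> x \<in> U \<longrightarrow>
        (\<exists>n\<ge>1. \<exists>k. \<exists>u\<in>U. \<exists>v\<in>U. u \<in> dom_pow T D f (n + k) \<and> v \<in> dom_pow T D f k \<and>
           (f ^^ (n + k)) u = (f ^^ k) v))"
proof -
  have quantifier: "(\<forall>n\<ge>1. P n) \<longleftrightarrow> (\<forall>n\<ge>1. P (int n))" for P :: "int \<Rightarrow> bool"
  proof
    assume R: "\<forall>n\<ge>1. P (int n)"
    show "\<forall>n\<ge>1. P n"
    proof (intro allI impI)
      fix n :: int assume "1 \<le> n"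
      then show "P n" using R[rule_format, of "nat n"] by simp
    qed
  qed simp
  show ?thesis
    unfolding nonwandering_points_def wandering_points_def quantifier
    by (auto simp: pow_image_disjoint_iff openin_subset cong: conj_cong)
qed

text \<open>
  Forward, \<open>u\<close> and \<open>v\<close> are taken in the domain and pushed forward by continuity; this consumes one
  application of \<open>\<sigma>\<close>, so \<open>k\<close> must be positive, and \<open>k = 0\<close> can be raised to \<open>1\<close> because \<open>v\<close> lies in
  the domain. Backward, \<open>u\<close> and \<open>v\<close> are lifted to the given neighbourhood by openness.
\<close>

lemma nonwandering_image_iff:
  assumes x: "x \<in> D"
  shows "f x \<in> nonwandering_points T D f \<longleftrightarrow> x \<in> nonwandering_points T D f"
proof
  assume nw: "f x \<in> nonwandering_points T D f"
  show "x \<in> nonwandering_points T D f"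
    unfolding nonwandering_iff
  proof (intro conjI allI impI)
    show "x \<in> topspace T" using x Dom_subset by blast
    fix U assume U: "openin T U \<and> x \<in> U"
    then have "openin T (f ` (U \<inter> D)) \<and> f x \<in> f ` (U \<inter> D)"
      using x openin_image by blast
    then obtain n k u v where n: "n \<ge> 1" and u: "u \<in> U" "u \<in> D" and v: "v \<in> U" "v \<in> D"
      and dom: "f u \<in> dom_pow T D f (n + k)" "f v \<in> dom_pow T D f k"
      and eq: "(f ^^ (n + k)) (f u) = (f ^^ k) (f v)"
      using nw unfolding nonwandering_iff by blast
    have "u \<in> dom_pow T D f (n + Suc k)" "v \<in> dom_pow T D f (Suc k)"
      using u v dom by simp_all
    moreover have "(f ^^ (n + Suc k)) u = (f ^^ Suc k) v"
      using eq by (simp add: funpow_swap1)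
    ultimately show "\<exists>n\<ge>1. \<exists>k. \<exists>u\<in>U. \<exists>v\<in>U. u \<in> dom_pow T D f (n + k) \<and>
        v \<in> dom_pow T D f k \<and> (f ^^ (n + k)) u = (f ^^ k) v"
      using n u(1) v(1) by blast
  qed
next
  assume nw: "x \<in> nonwandering_points T D f"
  show "f x \<in> nonwandering_points T D f"
    unfolding nonwandering_iff
  proof (intro conjI allI impI)
    show "f x \<in> topspace T" using x by (rule map_in_topspace)
    fix U assume U: "openin T U \<and> f x \<in> U"
    then have "openin T {y \<in> D. f y \<in> U} \<and> x \<in> {y \<in> D. f y \<in> U}"
      using x openin_preimage by blast
    then obtain n k u v where n: "n \<ge> 1" and u: "u \<in> D" "f u \<in> U" and v: "v \<in> D" "f v \<in> U"
      and dom: "u \<in> dom_pow T D f (n + k)" "v \<in> dom_pow T D f k"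
      and eq: "(f ^^ (n + k)) u = (f ^^ k) v"
      using nw unfolding nonwandering_iff by blast
    obtain j where j: "u \<in> dom_pow T D f (n + Suc j)" "v \<in> dom_pow T D f (Suc j)"
      "(f ^^ (n + Suc j)) u = (f ^^ Suc j) v"
    proof (cases k)
      case 0
      \<comment> \<open>Here \<open>\<sigma>\<^sup>n(u) = v\<close>, and \<open>v\<close> lies in the domain.\<close>
      have "v \<in> dom_pow T D f 1" using v(1) map_in_topspace by simp
      moreover have "u \<in> dom_pow T D f (n + 1)"
        unfolding dom_pow_add using calculation dom(1) eq 0 by simp
      ultimately show ?thesis using that[of 0] eq 0 by simp
    next
      case (Suc j)
      then show ?thesis using that[of j] dom eq by simp
    qed
    have "f u \<in> dom_pow T D f (n + j)" "f v \<in> dom_pow T D f j"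
      "(f ^^ (n + j)) (f u) = (f ^^ j) (f v)"
      using j by (simp_all add: funpow_swap1)
    then show "\<exists>n\<ge>1. \<exists>k. \<exists>u\<in>U. \<exists>v\<in>U. u \<in> dom_pow T D f (n + k) \<and>
        v \<in> dom_pow T D f k \<and> (f ^^ (n + k)) u = (f ^^ k) v"
      using n u(2) v(2) by blast
  qed
qed

lemma nonwandering_funpow_iff:
  "x \<in> dom_pow T D f n \<Longrightarrow>
    (f ^^ n) x \<in> nonwandering_points T D f \<longleftrightarrow> x \<in> nonwandering_points T D f"
proof (induction n arbitrary: x)
  case 0
  then show ?case by simp
next
  case (Suc n)
  then have "(f ^^ n) (f x) \<in> nonwandering_points T D f \<longleftrightarrow> f x \<in> nonwandering_points T D f"
    by simp
  then show ?case using nonwandering_image_iff Suc.prems by (simp add: funpow_swap1)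
qed

lemma wandering_iff:
  "x \<in> topspace T \<Longrightarrow> x \<in> wandering_points T D f \<longleftrightarrow> x \<notin> nonwandering_points T D f"
  by (simp add: nonwandering_points_def)

end


section \<open>The shift on a subshift\<close>

lemma shift_funpow: "(shift ^^ n) x = suffix n x"
  by (induction n) (simp_all add: shift_def)

lemma suffix_full_seqs: "x \<in> full_seqs A \<Longrightarrow> suffix n x \<in> full_seqs A"
  by (auto simp: full_seqs_def suffix_def)

lemma suffix_otw_inf:
  assumes "x \<in> otw_inf A F"
  shows "suffix n x \<in> otw_inf A F"
proof -
  have "suffix n x \<in> full_inf A"
    using assms suffix_full_seqs by (fastforce simp: otw_inf_def full_inf_def)
  moreover have "subsequence (suffix n x) k (Suc j) \<notin> map Some ` F" if "k \<le> j" for k j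
  proof -
    have "subsequence (suffix n x) k (Suc j) = subsequence x (n + k) (Suc (n + j))"
      by (rule nth_equalityI) (simp_all add: subsequence_def suffix_def add.assoc del: upt_Suc)
    then show ?thesis using assms that by (simp add: otw_inf_def)
  qed
  ultimately show ?thesis by (simp add: otw_inf_def)
qed

lemma otw_inf_in_dom_pow: "x \<in> otw_inf A F \<Longrightarrow> x \<in> dom_pow (otw_topology A F) (otw_dom A F) shift n"
proof (induction n arbitrary: x)
  case 0
  then show ?case by (simp add: topspace_otw_topology otw_subshift_def)
next
  case (Suc n)
  have "x \<noteq> empty_word"
    using Suc.prems by (auto simp: otw_inf_def full_inf_def empty_word_def)
  then have "x \<in> otw_dom A F"
    using Suc.prems by (simp add: otw_dom_def otw_subshift_def)
  moreover have "shift x \<in> otw_inf A F"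
    unfolding shift_def using Suc.prems by (rule suffix_otw_inf)
  ultimately show ?case using Suc.IH by simp
qed

lemma fin_word_Nil: "fin_word [] = empty_word"
  by (simp add: fin_word_def)

lemma fin_word_Cons_neq_empty: "fin_word (a # \<alpha>) \<noteq> empty_word"
proof -
  have "fin_word (a # \<alpha>) 0 \<noteq> empty_word 0"
    by (simp add: fin_word_def empty_word_def)
  then show ?thesis by metis
qed

lemma shift_map_Some_Cons: "suffix 1 (map Some (a # \<alpha>) \<frown> y) = map Some \<alpha> \<frown> y"
  by (rule ext) (simp add: suffix_def conc_def)

lemma shift_fin_word_Cons: "shift (fin_word (a # \<alpha>)) = fin_word \<alpha>"
  unfolding shift_def fin_word_def by (rule shift_map_Some_Cons)

text \<open>The word witnessing membership is determined by the sequence: \<open>fin_word\<close> is injective.\<close>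

lemma fin_word_in_otw_fin_iff:
  "fin_word \<alpha> \<in> otw_fin A F \<longleftrightarrow> fin_word \<alpha> \<in> full_fin A \<and>
     infinite {a \<in> A. \<exists>y \<in> full_inf A. map Some (\<alpha> @ [a]) \<frown> y \<in> otw_inf A F}"
proof -
  have "\<alpha> = \<beta>" if eq: "fin_word \<alpha> = fin_word \<beta>" for \<alpha> \<beta> :: "'a list"
    using eq
  proof (induction \<alpha> arbitrary: \<beta>)
    case Nil
    then show ?case
      by (cases \<beta>) (simp_all add: fin_word_Nil fin_word_Cons_neq_empty[symmetric])
  next
    case (Cons a \<alpha>)
    then obtain b \<gamma> where \<beta>: "\<beta> = b # \<gamma>"
      by (cases \<beta>) (simp_all add: fin_word_Nil fin_word_Cons_neq_empty)
    have "fin_word \<alpha> = fin_word \<gamma>"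
      using Cons.prems unfolding \<beta> by (metis shift_fin_word_Cons)
    moreover have "a = b"
      using fun_cong[OF Cons.prems, of 0] unfolding \<beta> by (simp add: fin_word_def)
    ultimately show ?case using Cons.IH \<beta> by blast
  qed
  then show ?thesis unfolding otw_fin_def by blast
qed

text \<open>
  Every letter \<open>b\<close> that continues \<open>a\<alpha>\<close> to an infinite sequence of the subshift also continues
  \<open>\<alpha>\<close>, because the infinite part is shift invariant.
\<close>

lemma shift_otw_fin:
  assumes "fin_word (a # \<alpha>) \<in> otw_fin A F"
  shows "fin_word \<alpha> \<in> otw_fin A F"
proof -
  let ?E = "\<lambda>\<alpha>. {b \<in> A. \<exists>y \<in> full_inf A. map Some (\<alpha> @ [b]) \<frown> y \<in> otw_inf A F}"
  have "fin_word (a # \<alpha>) \<in> full_seqs A"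
    using assms by (simp add: otw_fin_def full_fin_def)
  then have "fin_word \<alpha> \<in> full_seqs A"
    by (metis shift_fin_word_Cons shift_def suffix_full_seqs)
  moreover have "fin_word \<alpha> (length \<alpha>) = None"
    by (simp add: fin_word_def empty_word_def)
  then have "fin_word \<alpha> \<notin> full_inf A"
    unfolding full_inf_def by (metis (mono_tags, lifting) imageE mem_Collect_eq option.distinct(1) rangeI subsetD)
  ultimately have full: "fin_word \<alpha> \<in> full_fin A" by (simp add: full_fin_def)
  have "map Some (\<alpha> @ [b]) \<frown> y \<in> otw_inf A F"
    if "map Some ((a # \<alpha>) @ [b]) \<frown> y \<in> otw_inf A F" for b y
    using suffix_otw_inf[OF that, of 1] shift_map_Some_Cons[of a "\<alpha> @ [b]" y] by simp
  then have "?E (a # \<alpha>) \<subseteq> ?E \<alpha>" by blast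
  moreover have "infinite (?E (a # \<alpha>))"
    using assms unfolding fin_word_in_otw_fin_iff by blast
  ultimately have "infinite (?E \<alpha>)" using infinite_super by blast
  with full show ?thesis unfolding fin_word_in_otw_fin_iff by blast
qed

lemma fin_word_reaches_empty_word:
  "fin_word \<alpha> \<in> otw_fin A F \<Longrightarrow>
    fin_word \<alpha> \<in> dom_pow (otw_topology A F) (otw_dom A F) shift (length \<alpha>) \<and>
    (shift ^^ length \<alpha>) (fin_word \<alpha>) = empty_word \<and> empty_word \<in> otw_fin A F"
proof (induction \<alpha>)
  case Nil
  then show ?case
    by (simp add: fin_word_Nil topspace_otw_topology otw_subshift_def)
next
  case (Cons a \<alpha>)
  have "fin_word (a # \<alpha>) \<in> otw_dom A F"
    using Cons.prems fin_word_Cons_neq_empty[of a \<alpha>] by (simp add: otw_dom_def otw_subshift_def)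
  then show ?case
    using Cons.IH[OF shift_otw_fin[OF Cons.prems]]
    by (simp add: shift_fin_word_Cons funpow_swap1)
qed


section \<open>Rational sequences\<close>

lemma rational_imp_otw_inf:
  assumes "x \<in> otw_subshift A F" "rational A x"
  shows "x \<in> otw_inf A F"
proof -
  obtain \<alpha> \<beta> where \<alpha>: "\<alpha> \<in> lists A" and \<beta>: "\<beta> \<in> lists A" "\<beta> \<noteq> []"
    and x: "x = map Some \<alpha> \<frown> (map Some \<beta>)\<^sup>\<omega>"
    using assms(2) unfolding rational_def by blast
  have "x i \<in> Some ` A" for i
    using \<alpha> \<beta> unfolding x by (auto simp: conc_def iter_def in_listsD)
  then have "x \<notin> full_fin A"
    unfolding full_fin_def full_inf_def by blast
  then show ?thesis
    using assms(1) by (simp add: otw_subshift_def otw_fin_def)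
qed

lemma rational_iff_suffix_eq:
  assumes x: "x \<in> full_inf A"
  shows "rational A x \<longleftrightarrow> (\<exists>n\<ge>1. \<exists>k. suffix (n + k) x = suffix k x)"
proof
  assume "rational A x"
  then obtain \<alpha> \<beta> where \<beta>: "\<beta> \<noteq> []" and x: "x = map Some \<alpha> \<frown> (map Some \<beta>)\<^sup>\<omega>"
    unfolding rational_def by blast
  have "suffix (length \<beta> + length \<alpha>) x = suffix (length \<alpha>) x"
    unfolding x by (rule ext) (use \<beta> in \<open>simp add: suffix_def conc_def iter_def\<close>)
  moreover have "length \<beta> \<ge> 1" using \<beta> by (simp add: Suc_le_eq)
  ultimately show "\<exists>n\<ge>1. \<exists>k. suffix (n + k) x = suffix k x" by blast
next
  assume "\<exists>n\<ge>1. \<exists>k. suffix (n + k) x = suffix k x"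
  then obtain n k where n: "n \<ge> 1" and eq: "suffix (n + k) x = suffix k x" by blast
  have step: "x (k + i + n) = x (k + i)" for i
    using fun_cong[OF eq, of i] by (simp add: suffix_def add_ac)
  have "x (k + i + m * n) = x (k + i)" for i m
  proof (induction m)
    case (Suc m)
    then show ?case using step[of "i + m * n"] by (simp add: add_ac)
  qed simp
  from this[of "i mod n" "i div n" for i]
  have periodic: "x (k + i) = x (k + i mod n)" for i
    by (simp add: add.assoc)
  \<comment> \<open>Hence \<open>x\<close> has the preperiod \<open>x\<^sub>0 \<dots> x\<^sub>k\<^sub>-\<^sub>1\<close> and the period \<open>x\<^sub>k \<dots> x\<^sub>k\<^sub>+\<^sub>n\<^sub>-\<^sub>1\<close>.\<close>
  have letter: "x i \<in> Some ` A" for i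
    using x by (auto simp: full_inf_def)
  then have Some_the: "Some (the (x i)) = x i" and the_in: "the (x i) \<in> A" for i
    by (metis imageE option.sel)+
  let ?\<alpha> = "map (\<lambda>i. the (x i)) [0..<k]"
  let ?\<beta> = "map (\<lambda>i. the (x (k + i))) [0..<n]"
  have "x = map Some ?\<alpha> \<frown> (map Some ?\<beta>)\<^sup>\<omega>"
  proof
    fix i
    show "x i = (map Some ?\<alpha> \<frown> (map Some ?\<beta>)\<^sup>\<omega>) i"
      using n periodic[of "i - k"] by (cases "i < k") (simp_all add: conc_def iter_def Some_the)
  qed
  moreover have "?\<alpha> \<in> lists A" "?\<beta> \<in> lists A" using the_in by auto
  moreover have "?\<beta> \<noteq> []" using n by simp
  ultimately show "rational A x" unfolding rational_def by blast
qed


section \<open>Classification of the points of a subshift\<close>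

theorem proposition3p12:
  fixes A :: "'a set" and F :: "'a list set"
  assumes "countable A"
    and "F \<subseteq> lists A"
    and "DR_system (otw_topology A F) (otw_dom A F) shift"
  shows "(\<forall>x \<in> otw_subshift A F. rational A x \<longrightarrow> x \<in> otw_nonwandering A F) \<and>
    (\<forall>z \<in> otw_subshift A F.
       (\<forall>U. openin (otw_topology A F) U \<and> z \<in> U \<longrightarrow> (\<exists>r \<in> U. rational A r))
         \<longrightarrow> z \<in> otw_nonwandering A F) \<and>
    (\<forall>x \<in> otw_inf A F.
       \<not> rational A x \<and> openin (otw_topology A F) {x} \<longrightarrow> x \<in> otw_wandering A F) \<and>
    ((otw_fin A F \<subseteq> otw_nonwandering A F \<or> otw_fin A F \<subseteq> otw_wandering A F) \<and>
     (empty_word \<in> otw_nonwandering A F \<longrightarrow> otw_fin A F \<subseteq> otw_nonwandering A F) \<and>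
     (empty_word \<in> otw_wandering A F \<longrightarrow> otw_fin A F \<subseteq> otw_wandering A F))"
proof -
  let ?T = "otw_topology A F" and ?D = "otw_dom A F"
  interpret DR_system ?T ?D shift by (rule assms(3))
  have suffix_eq: "rational A x \<longleftrightarrow> (\<exists>n\<ge>1. \<exists>k. suffix (n + k) x = suffix k x)"
    if "x \<in> otw_inf A F" for x
    using that rational_iff_suffix_eq by (auto simp: otw_inf_def)
  have rational_nw: "x \<in> otw_nonwandering A F" if x: "x \<in> otw_subshift A F" "rational A x" for x
  proof -
    have inf: "x \<in> otw_inf A F" using x by (rule rational_imp_otw_inf)
    obtain n k where "n \<ge> 1" "(shift ^^ (n + k)) x = (shift ^^ k) x"
      using x(2) suffix_eq[OF inf] unfolding shift_funpow by blast
    then show ?thesis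
      unfolding nonwandering_iff topspace_otw_topology
      using x(1) otw_inf_in_dom_pow[OF inf] by blast
  qed
  have limit_nw: "z \<in> otw_nonwandering A F"
    if z: "z \<in> otw_subshift A F"
      and limit: "\<forall>U. openin ?T U \<and> z \<in> U \<longrightarrow> (\<exists>r \<in> U. rational A r)" for z
    unfolding nonwandering_iff
  proof (intro conjI allI impI)
    show "z \<in> topspace ?T" using z by (simp add: topspace_otw_topology)
    fix U assume U: "openin ?T U \<and> z \<in> U"
    then obtain r where r: "r \<in> U" "rational A r" using limit by blast
    then have "r \<in> otw_nonwandering A F"
      using U openin_subset[of ?T U] rational_nw by (auto simp: topspace_otw_topology)
    then show "\<exists>n\<ge>1. \<exists>k. \<exists>u\<in>U. \<exists>v\<in>U. u \<in> dom_pow ?T ?D shift (n + k) \<and>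
        v \<in> dom_pow ?T ?D shift k \<and> (shift ^^ (n + k)) u = (shift ^^ k) v"
      using U r(1) unfolding nonwandering_iff by blast
  qed
  have isolated_w: "x \<in> otw_wandering A F"
    if x: "x \<in> otw_inf A F" "\<not> rational A x" "openin ?T {x}" for x
  proof -
    have "x \<notin> otw_nonwandering A F"
    proof
      assume "x \<in> otw_nonwandering A F"
      then have "\<exists>n\<ge>1. \<exists>k. suffix (n + k) x = suffix k x"
        using x(3) unfolding nonwandering_iff shift_funpow by blast
      then show False using x(2) suffix_eq[OF x(1)] by blast
    qed
    then show ?thesis
      using x(1) by (simp add: wandering_iff topspace_otw_topology otw_subshift_def)
  qed
  have fin: "empty_word \<in> otw_fin A F \<and>
      (x \<in> otw_nonwandering A F \<longleftrightarrow> empty_word \<in> otw_nonwandering A F)"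
    if x: "x \<in> otw_fin A F" for x
  proof -
    obtain \<alpha> where \<alpha>: "x = fin_word \<alpha>" using x by (auto simp: otw_fin_def)
    show ?thesis
      using fin_word_reaches_empty_word[of \<alpha>] nonwandering_funpow_iff[of x "length \<alpha>"] x \<alpha> by auto
  qed
  have fin_top: "otw_fin A F \<subseteq> topspace ?T"
    by (simp add: topspace_otw_topology otw_subshift_def)
  have fin_nw: "otw_fin A F \<subseteq> otw_nonwandering A F" if "empty_word \<in> otw_nonwandering A F"
    using fin that by blast
  have fin_w: "otw_fin A F \<subseteq> otw_wandering A F" if "empty_word \<notin> otw_nonwandering A F"
    using fin that fin_top wandering_iff by blast
  have "empty_word \<notin> otw_nonwandering A F" if "empty_word \<in> otw_wandering A F"
    using that by (simp add: nonwandering_points_def)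
  then show ?thesis
    using rational_nw limit_nw isolated_w fin_nw fin_w by blast
qed

end
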